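(* Let $R$ be an algebra over a field of characteristic $p>0$, let $\sigma$ be a locally torsion automorphism of $R$, and let $D$ be a locally nilpotent $\sigma$-derivation on $R$. If $\sigma D=D\sigma$, then $J(R[x;\sigma,D])\cap R$ is a nil ideal of $R$.
   Context: Rings and algebras are associative and need not have an identity. For a ring $S$, $J(S)$ denotes its Jacobson radical. An automorphism $\sigma$ of $R$ is locally torsion if for every $a\in R$ there is an integer $n=n_a>0$ with $\sigma^n(a)=a$. A $\sigma$-derivation of $R$ is an additive map $D:R\to R$ with $D(ab)=\sigma(a)D(b)+D(a)b$ for all $a,b\in R$; it is locally nilpotent if for every $a\in R$ there is an integer $m=m_a>0$ with $D^m(a)=0$. The Ore extension $R[x;\sigma,D]$ is the ring of polynomials $a_nx^n+\dots+a_1x+a_0$ with $n\ge 0$ and $a_i\in R$, with the usual addition and with multiplication determined by $xa=\sigma(a)x+D(a)$ for $a\in R$; $R$ is identified with the constant polynomials. *)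

theory Defs
  imports "HOL-Computational_Algebra.Polynomial"
begin

section \<open>Associative rings without identity\<close>

text \<open>
  The multiplication of an Ore extension depends on \<open>\<sigma>\<close> and \<open>D\<close>, so it cannot be supplied by a
  type class.  Ring-theoretic notions are therefore stated for an arbitrary multiplication on an
  additive group; for a ring \<open>R\<close> given by the class \<^class>\<open>ring\<close> it is instantiated with \<open>(*)\<close>.
\<close>

locale nonunital_ring =
  fixes mul :: "'b::ab_group_add \<Rightarrow> 'b \<Rightarrow> 'b" (infixl \<open>\<cdot>\<close> 70)
  assumes mul_assoc: "(a \<cdot> b) \<cdot> c = a \<cdot> (b \<cdot> c)"
    and mul_add_left: "(a + b) \<cdot> c = a \<cdot> c + b \<cdot> c"
    and mul_add_right: "a \<cdot> (b + c) = a \<cdot> b + a \<cdot> c"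

definition left_ideal :: "('b::ab_group_add \<Rightarrow> 'b \<Rightarrow> 'b) \<Rightarrow> 'b set \<Rightarrow> bool" where
  "left_ideal mul I \<longleftrightarrow> 0 \<in> I \<and> (\<forall>a\<in>I. \<forall>b\<in>I. a + b \<in> I) \<and> (\<forall>a\<in>I. - a \<in> I) \<and>
     (\<forall>s. \<forall>a\<in>I. mul s a \<in> I)"

definition two_sided_ideal :: "('b::ab_group_add \<Rightarrow> 'b \<Rightarrow> 'b) \<Rightarrow> 'b set \<Rightarrow> bool" where
  "two_sided_ideal mul I \<longleftrightarrow> left_ideal mul I \<and> (\<forall>s. \<forall>a\<in>I. mul a s \<in> I)"

text \<open>The iterate below is the power \<open>a\<^bsup>n+1\<^esup>\<close>; there is no \<open>a\<^sup>0\<close> without an identity.\<close>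

definition nilpotent_elem :: "('b::ab_group_add \<Rightarrow> 'b \<Rightarrow> 'b) \<Rightarrow> 'b \<Rightarrow> bool" where
  "nilpotent_elem mul a \<longleftrightarrow> (\<exists>n. (mul a ^^ n) a = 0)"

definition nil_ideal :: "('b::ab_group_add \<Rightarrow> 'b \<Rightarrow> 'b) \<Rightarrow> 'b set \<Rightarrow> bool" where
  "nil_ideal mul I \<longleftrightarrow> two_sided_ideal mul I \<and> (\<forall>a\<in>I. nilpotent_elem mul a)"


section \<open>The Jacobson radical\<close>

definition modular_maximal_left_ideal :: "('b::ab_group_add \<Rightarrow> 'b \<Rightarrow> 'b) \<Rightarrow> 'b set \<Rightarrow> bool" where
  "modular_maximal_left_ideal mul L \<longleftrightarrow>
     left_ideal mul L \<and> L \<noteq> UNIV \<and> (\<forall>M. left_ideal mul M \<longrightarrow> L \<subseteq> M \<longrightarrow> M = L \<or> M = UNIV) \<and>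
     (\<exists>e. \<forall>s. s - mul s e \<in> L)"

text \<open>
  The simple left modules of a ring without identity are the quotients by modular maximal left
  ideals, so this is also the intersection of the annihilators of the simple left modules.  The
  radical is the whole ring if there is no modular maximal left ideal.
\<close>

definition jacobson_radical :: "('b::ab_group_add \<Rightarrow> 'b \<Rightarrow> 'b) \<Rightarrow> 'b set" where
  "jacobson_radical mul = \<Inter> {L. modular_maximal_left_ideal mul L}"

text \<open>
  The lemmas of the next block show that the radical is the largest quasi-regular two-sided
  ideal; in particular, the choice of left rather than right ideals is immaterial.
\<close>

definition quasi_regular :: "('b::ab_group_add \<Rightarrow> 'b \<Rightarrow> 'b) \<Rightarrow> 'b \<Rightarrow> bool" where
  "quasi_regular mul a \<longleftrightarrow> (\<exists>b. a + b - mul a b = 0 \<and> b + a - mul b a = 0)"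

context nonunital_ring
begin

lemma mul_zero_left [simp]: "0 \<cdot> a = 0"
  using mul_add_left[of 0 0 a] by simp

lemma mul_zero_right [simp]: "a \<cdot> 0 = 0"
  using mul_add_right[of a 0 0] by simp

lemma mul_minus_left: "(- a) \<cdot> b = - (a \<cdot> b)"
  using mul_add_left[of "- a" a b] by (simp add: eq_neg_iff_add_eq_0)

lemma mul_minus_right: "a \<cdot> (- b) = - (a \<cdot> b)"
  using mul_add_right[of a "- b" b] by (simp add: eq_neg_iff_add_eq_0)

lemma mul_diff_left: "(a - b) \<cdot> c = a \<cdot> c - b \<cdot> c"
  using mul_add_left[of a "- b" c] by (simp add: mul_minus_left)

lemma mul_diff_right: "a \<cdot> (b - c) = a \<cdot> b - a \<cdot> c"
  using mul_add_right[of a b "- c"] by (simp add: mul_minus_right)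

lemma left_idealD:
  assumes "left_ideal mul I"
  shows "0 \<in> I" "a \<in> I \<Longrightarrow> b \<in> I \<Longrightarrow> a + b \<in> I" "a \<in> I \<Longrightarrow> - a \<in> I"
    "a \<in> I \<Longrightarrow> s \<cdot> a \<in> I" "a \<in> I \<Longrightarrow> b \<in> I \<Longrightarrow> a - b \<in> I"
proof -
  show "a - b \<in> I" if "a \<in> I" "b \<in> I"
    using assms that unfolding left_ideal_def by (metis diff_conv_add_uminus)
qed (use assms in \<open>auto simp: left_ideal_def\<close>)

lemma left_ideal_eq_UNIV:
  assumes "left_ideal mul L" "\<And>s. s - s \<cdot> e \<in> L" "e \<in> L"
  shows "L = UNIV"
proof -
  have "s \<in> L" for s
    using left_idealD(2)[OF assms(1) assms(2)[of s] left_idealD(4)[OF assms(1,3), of s]] by simp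
  then show ?thesis by blast
qed

lemma left_ideal_set_sum:
  assumes "left_ideal mul I" "left_ideal mul L"
  shows "left_ideal mul {i + l | i l. i \<in> I \<and> l \<in> L}"
  unfolding left_ideal_def
proof (intro conjI ballI allI)
  show "0 \<in> {i + l |i l. i \<in> I \<and> l \<in> L}"
    using left_idealD(1)[OF assms(1)] left_idealD(1)[OF assms(2)] by force
next
  fix a b assume "a \<in> {i + l |i l. i \<in> I \<and> l \<in> L}" "b \<in> {i + l |i l. i \<in> I \<and> l \<in> L}"
  then obtain i l i' l' where *: "a = i + l" "b = i' + l'" "i \<in> I" "i' \<in> I" "l \<in> L" "l' \<in> L"
    by blast
  have "a + b = (i + i') + (l + l')" by (simp add: * algebra_simps)
  then show "a + b \<in> {i + l |i l. i \<in> I \<and> l \<in> L}"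
    using left_idealD(2)[OF assms(1)] left_idealD(2)[OF assms(2)] * by blast
next
  fix a assume "a \<in> {i + l |i l. i \<in> I \<and> l \<in> L}"
  then obtain i l where *: "a = i + l" "i \<in> I" "l \<in> L" by blast
  have "- a = (- i) + (- l)" by (simp add: *)
  then show "- a \<in> {i + l |i l. i \<in> I \<and> l \<in> L}"
    using left_idealD(3)[OF assms(1)] left_idealD(3)[OF assms(2)] * by blast
next
  fix s a assume "a \<in> {i + l |i l. i \<in> I \<and> l \<in> L}"
  then obtain i l where *: "a = i + l" "i \<in> I" "l \<in> L" by blast
  have "s \<cdot> a = s \<cdot> i + s \<cdot> l" by (simp add: * mul_add_right)
  then show "s \<cdot> a \<in> {i + l |i l. i \<in> I \<and> l \<in> L}"
    using left_idealD(4)[OF assms(1)] left_idealD(4)[OF assms(2)] * by blast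
qed

lemma left_ideal_right_translate:
  assumes "left_ideal mul N"
  shows "left_ideal mul ((\<lambda>s. s \<cdot> t) ` N)"
  unfolding left_ideal_def
proof (intro conjI ballI allI)
  show "0 \<in> (\<lambda>s. s \<cdot> t) ` N" using left_idealD(1)[OF assms] mul_zero_left by force
next
  fix a b assume "a \<in> (\<lambda>s. s \<cdot> t) ` N" "b \<in> (\<lambda>s. s \<cdot> t) ` N"
  then show "a + b \<in> (\<lambda>s. s \<cdot> t) ` N"
    using left_idealD(2)[OF assms] by (auto simp: mul_add_left[symmetric])
next
  fix a assume "a \<in> (\<lambda>s. s \<cdot> t) ` N"
  then show "- a \<in> (\<lambda>s. s \<cdot> t) ` N"
    using left_idealD(3)[OF assms] by (auto simp: mul_minus_left[symmetric])
next
  fix s a assume "a \<in> (\<lambda>s. s \<cdot> t) ` N"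
  then show "s \<cdot> a \<in> (\<lambda>s. s \<cdot> t) ` N"
    using left_idealD(4)[OF assms] by (auto simp: mul_assoc[symmetric])
qed

lemma modular_left_ideal_in_maximal:
  assumes L: "left_ideal mul L" "\<And>s. s - s \<cdot> e \<in> L" "L \<noteq> UNIV"
  obtains M where "modular_maximal_left_ideal mul M" "L \<subseteq> M" "\<And>s. s - s \<cdot> e \<in> M"
proof -
  define A where "A = {M. left_ideal mul M \<and> L \<subseteq> M \<and> e \<notin> M}"
  have "e \<notin> L" using left_ideal_eq_UNIV L by blast
  then have "L \<in> A" using L by (simp add: A_def)
  have "\<Union>C \<in> A" if C: "C \<noteq> {}" "subset.chain A C" for C
  proof -
    have sub: "C \<subseteq> A" and tot: "\<And>X Y. X \<in> C \<Longrightarrow> Y \<in> C \<Longrightarrow> X \<subseteq> Y \<or> Y \<subseteq> X"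
      using C(2) by (auto simp: subset.chain_def)
    then have li: "\<And>X. X \<in> C \<Longrightarrow> left_ideal mul X" by (auto simp: A_def)
    have "a + b \<in> \<Union>C" if ab: "a \<in> \<Union>C" "b \<in> \<Union>C" for a b
    proof -
      obtain X Y where XY: "X \<in> C" "Y \<in> C" "a \<in> X" "b \<in> Y" using ab by blast
      with tot[of X Y] obtain Z where "Z \<in> C" "a \<in> Z" "b \<in> Z" by blast
      then show ?thesis using left_idealD(2)[OF li] by blast
    qed
    moreover have "0 \<in> \<Union>C" using C(1) left_idealD(1)[OF li] by blast
    moreover have "- a \<in> \<Union>C" if "a \<in> \<Union>C" for a
      using that left_idealD(3)[OF li] by blast
    moreover have "s \<cdot> a \<in> \<Union>C" if "a \<in> \<Union>C" for s a
      using that left_idealD(4)[OF li] by blast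
    ultimately have "left_ideal mul (\<Union>C)" unfolding left_ideal_def by blast
    moreover have "L \<subseteq> \<Union>C" "e \<notin> \<Union>C" using C(1) sub by (auto simp: A_def)
    ultimately show ?thesis by (simp add: A_def)
  qed
  then obtain M where M: "M \<in> A" "\<And>X. X \<in> A \<Longrightarrow> M \<subseteq> X \<Longrightarrow> X = M"
    using subset_Zorn_nonempty[of A] \<open>L \<in> A\<close> by blast
  have modM: "s - s \<cdot> e \<in> M" for s using M(1) L(2) by (auto simp: A_def)
  have "N = M \<or> N = UNIV" if N: "left_ideal mul N" "M \<subseteq> N" for N
  proof (cases "e \<in> N")
    case True
    then show ?thesis using left_ideal_eq_UNIV[OF N(1)] modM N(2) by blast
  next
    case False
    then have "N \<in> A" using M(1) N by (auto simp: A_def)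
    then show ?thesis using M(2) N(2) by blast
  qed
  then have "modular_maximal_left_ideal mul M"
    using M(1) modM unfolding modular_maximal_left_ideal_def A_def by blast
  then show thesis using that[of M] M(1) modM by (auto simp: A_def)
qed

lemma jacobson_radical_left_ideal: "left_ideal mul (jacobson_radical mul)"
proof -
  have "left_ideal mul L" if "modular_maximal_left_ideal mul L" for L
    using that by (simp add: modular_maximal_left_ideal_def)
  then show ?thesis unfolding jacobson_radical_def left_ideal_def by auto
qed

lemma left_quasi_inverse_in_jacobson_radical:
  assumes "a \<in> jacobson_radical mul"
  obtains b where "b \<in> jacobson_radical mul" "b + a - b \<cdot> a = 0"
proof -
  define L where "L = range (\<lambda>s. s - s \<cdot> a)"
  have "left_ideal mul L"
    unfolding left_ideal_def L_def
  proof (intro conjI ballI allI)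
    show "0 \<in> range (\<lambda>s. s - s \<cdot> a)" by (rule range_eqI[of _ _ 0]) simp
  next
    fix u v assume "u \<in> range (\<lambda>s. s - s \<cdot> a)" "v \<in> range (\<lambda>s. s - s \<cdot> a)"
    then obtain s t where "u = s - s \<cdot> a" "v = t - t \<cdot> a" by blast
    then show "u + v \<in> range (\<lambda>s. s - s \<cdot> a)"
      by (intro range_eqI[of _ _ "s + t"]) (simp add: mul_add_left)
  next
    fix u assume "u \<in> range (\<lambda>s. s - s \<cdot> a)"
    then obtain s where "u = s - s \<cdot> a" by blast
    then show "- u \<in> range (\<lambda>s. s - s \<cdot> a)"
      by (intro range_eqI[of _ _ "- s"]) (simp add: mul_minus_left)
  next
    fix r u assume "u \<in> range (\<lambda>s. s - s \<cdot> a)"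
    then obtain s where "u = s - s \<cdot> a" by blast
    then show "r \<cdot> u \<in> range (\<lambda>s. s - s \<cdot> a)"
      by (intro range_eqI[of _ _ "r \<cdot> s"]) (simp add: mul_diff_right mul_assoc)
  qed
  moreover have modL: "s - s \<cdot> a \<in> L" for s by (simp add: L_def)
  moreover have "L = UNIV"
  proof (rule ccontr)
    assume "L \<noteq> UNIV"
    then obtain M where M: "modular_maximal_left_ideal mul M" "L \<subseteq> M" "\<And>s. s - s \<cdot> a \<in> M"
      using modular_left_ideal_in_maximal \<open>left_ideal mul L\<close> modL by metis
    have "a \<in> M" using assms M(1) by (auto simp: jacobson_radical_def)
    then have "M = UNIV"
      using left_ideal_eq_UNIV M(1,3) by (auto simp: modular_maximal_left_ideal_def)
    then show False using M(1) by (simp add: modular_maximal_left_ideal_def)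
  qed
  ultimately have "a \<in> L" by blast
  then obtain c where c: "a = c - c \<cdot> a" by (auto simp: L_def)
  have "- c = - (c \<cdot> a) - a"
    using arg_cong[OF c, of "\<lambda>x. - (c \<cdot> a) - x"] by simp
  then have "- c \<in> jacobson_radical mul"
    using left_idealD(3,4,5)[OF jacobson_radical_left_ideal] assms by metis
  moreover have "- c + a - (- c) \<cdot> a = 0"
    using c by (simp add: mul_minus_left algebra_simps)
  ultimately show thesis using that by blast
qed

lemma quasi_inverses_agree:
  assumes "c + b - c \<cdot> b = 0" "b + a - b \<cdot> a = 0"
  shows "c = a"
proof -
  have cb: "c \<cdot> b = c + b" and ba: "b \<cdot> a = b + a" using assms by (simp_all add: algebra_simps)
  have "c \<cdot> (b \<cdot> a) = (c \<cdot> b) \<cdot> a" by (simp add: mul_assoc)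
  then show ?thesis by (simp add: cb ba mul_add_left mul_add_right algebra_simps)
qed

lemma jacobson_radical_quasi_regular:
  assumes "a \<in> jacobson_radical mul"
  shows "quasi_regular mul a"
proof -
  obtain b where b: "b \<in> jacobson_radical mul" "b + a - b \<cdot> a = 0"
    using left_quasi_inverse_in_jacobson_radical assms by blast
  obtain c where c: "c + b - c \<cdot> b = 0"
    using left_quasi_inverse_in_jacobson_radical b(1) by blast
  have "c = a" using quasi_inverses_agree c b(2) by blast
  then show ?thesis using b c unfolding quasi_regular_def by blast
qed

theorem jacobson_radical_two_sided_ideal: "two_sided_ideal mul (jacobson_radical mul)"
  unfolding two_sided_ideal_def
proof (intro conjI allI ballI jacobson_radical_left_ideal)
  fix t a assume a: "a \<in> jacobson_radical mul"
  have "a \<cdot> t \<in> L" if "modular_maximal_left_ideal mul L" for L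
  proof -
    have L: "left_ideal mul L" "\<And>M. left_ideal mul M \<Longrightarrow> L \<subseteq> M \<Longrightarrow> M = L \<or> M = UNIV"
      using that by (auto simp: modular_maximal_left_ideal_def)
    define K where "K = {s. s \<cdot> t \<in> L}"
    have K: "left_ideal mul K"
      using left_idealD[OF L(1)]
      by (auto simp: left_ideal_def K_def mul_add_left mul_minus_left mul_assoc)
    have sum: "\<exists>n\<in>N. \<exists>l\<in>L. v = n \<cdot> t + l" if N: "left_ideal mul N" "u \<in> N" "u \<notin> K" for N u v
    proof -
      define S where "S = {i + l | i l. i \<in> (\<lambda>s. s \<cdot> t) ` N \<and> l \<in> L}"
      have "left_ideal mul S"
        unfolding S_def by (intro left_ideal_set_sum left_ideal_right_translate N L)
      moreover have "l \<in> S" if "l \<in> L" for l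
      proof -
        have "l = 0 \<cdot> t + l" by simp
        then show ?thesis unfolding S_def using left_idealD(1)[OF N(1)] that by blast
      qed
      moreover have "u \<cdot> t \<in> S"
      proof -
        have "u \<cdot> t = u \<cdot> t + 0" by simp
        then show ?thesis unfolding S_def using left_idealD(1)[OF L(1)] N(2) by blast
      qed
      moreover have "u \<cdot> t \<notin> L" using N(3) by (simp add: K_def)
      ultimately have "S = UNIV" using L(2) by blast
      then have "v \<in> S" by simp
      then show ?thesis unfolding S_def by blast
    qed
    have "a \<in> K"
    proof (cases "K = UNIV")
      case False
      then obtain u where u: "u \<notin> K" by blast
      have "left_ideal mul UNIV" by (simp add: left_ideal_def)
      then obtain f l where f: "t = f \<cdot> t + l" "l \<in> L" using sum[of UNIV u t] u by blast
      have "s - s \<cdot> f \<in> K" for s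
      proof -
        have "s \<cdot> t - s \<cdot> (f \<cdot> t) = s \<cdot> l"
          using arg_cong[OF f(1), of "\<lambda>x. s \<cdot> x"] by (simp add: mul_add_right)
        then show ?thesis
          using left_idealD(4)[OF L(1) f(2), of s] by (simp add: K_def mul_diff_left mul_assoc)
      qed
      moreover have "N = K \<or> N = UNIV" if N: "left_ideal mul N" "K \<subseteq> N" for N
      proof (cases "N = K")
        case False
        then obtain n where n: "n \<in> N" "n \<notin> K" using N(2) by blast
        have "s \<in> N" for s
        proof -
          obtain m l where m: "m \<in> N" "l \<in> L" "s \<cdot> t = m \<cdot> t + l"
            using sum[OF N(1) n, of "s \<cdot> t"] by blast
          have "s - m \<in> K" using m by (simp add: K_def mul_diff_left)
          then have "(s - m) + m \<in> N" using left_idealD(2)[OF N(1)] N(2) m(1) by blast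
          then show ?thesis by simp
        qed
        then show ?thesis by blast
      qed simp
      ultimately have "modular_maximal_left_ideal mul K"
        unfolding modular_maximal_left_ideal_def using K False by blast
      then show ?thesis using a by (auto simp: jacobson_radical_def)
    qed simp
    then show ?thesis by (simp add: K_def)
  qed
  then show "a \<cdot> t \<in> jacobson_radical mul" by (auto simp: jacobson_radical_def)
qed

theorem quasi_regular_left_ideal_subset_jacobson_radical:
  assumes I: "left_ideal mul I" and qr: "\<And>a. a \<in> I \<Longrightarrow> quasi_regular mul a"
  shows "I \<subseteq> jacobson_radical mul"
proof (rule ccontr)
  assume "\<not> I \<subseteq> jacobson_radical mul"
  then obtain L a where La: "modular_maximal_left_ideal mul L" "a \<in> I" "a \<notin> L"
    by (auto simp: jacobson_radical_def)
  then obtain e where L: "left_ideal mul L" "L \<noteq> UNIV" "\<And>s. s - s \<cdot> e \<in> L"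
      "\<And>M. left_ideal mul M \<Longrightarrow> L \<subseteq> M \<Longrightarrow> M = L \<or> M = UNIV"
    unfolding modular_maximal_left_ideal_def by blast
  define S where "S = {i + l | i l. i \<in> I \<and> l \<in> L}"
  have "left_ideal mul S" unfolding S_def by (intro left_ideal_set_sum I L)
  moreover have "l \<in> S" if "l \<in> L" for l
  proof -
    have "l = 0 + l" by simp
    then show ?thesis unfolding S_def using left_idealD(1)[OF I] that by blast
  qed
  moreover have "a \<in> S"
  proof -
    have "a = a + 0" by simp
    then show ?thesis unfolding S_def using left_idealD(1)[OF L(1)] La(2) by blast
  qed
  ultimately have "S = UNIV" using L(4) La(3) by blast
  then have "e \<in> S" by simp
  then obtain i l where e: "e = i + l" "i \<in> I" "l \<in> L" unfolding S_def by blast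
  obtain b where b: "b + i - b \<cdot> i = 0" using qr[OF e(2)] by (auto simp: quasi_regular_def)
  have "b - b \<cdot> e = (b - b \<cdot> i) - b \<cdot> l" by (simp add: e(1) mul_add_right algebra_simps)
  also have "b - b \<cdot> i = - i" using b by (simp add: eq_neg_iff_add_eq_0 algebra_simps)
  finally have "i = - ((b - b \<cdot> e) + b \<cdot> l)" by simp
  then have "i \<in> L"
    using left_idealD(2,3)[OF L(1)] L(3)[of b] left_idealD(4)[OF L(1) e(3), of b] by metis
  then have "e \<in> L" using left_idealD(2)[OF L(1)] e by blast
  then show False using left_ideal_eq_UNIV[OF L(1,3)] L(2) by blast
qed

end


section \<open>Skew derivations and Ore extensions\<close>

definition ring_automorphism :: "('a::ring \<Rightarrow> 'a) \<Rightarrow> bool" where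
  "ring_automorphism \<sigma> \<longleftrightarrow> bij \<sigma> \<and> additive \<sigma> \<and> (\<forall>a b. \<sigma> (a * b) = \<sigma> a * \<sigma> b)"

definition locally_torsion :: "('a \<Rightarrow> 'a) \<Rightarrow> bool" where
  "locally_torsion \<sigma> \<longleftrightarrow> (\<forall>a. \<exists>n>0. (\<sigma> ^^ n) a = a)"

definition skew_derivation :: "('a::ring \<Rightarrow> 'a) \<Rightarrow> ('a \<Rightarrow> 'a) \<Rightarrow> bool" where
  "skew_derivation \<sigma> D \<longleftrightarrow> additive D \<and> (\<forall>a b. D (a * b) = \<sigma> a * D b + D a * b)"

definition locally_nilpotent :: "('a::zero \<Rightarrow> 'a) \<Rightarrow> bool" where
  "locally_nilpotent D \<longleftrightarrow> (\<forall>a. \<exists>m>0. (D ^^ m) a = 0)"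

text \<open>
  The polynomial \<open>a\<^sub>0 + a\<^sub>1 x + \<dots> + a\<^sub>n x\<^sup>n\<close> is the element of \<^typ>\<open>'a poly\<close> with these (left)
  coefficients.  As \<open>R\<close> need not have an identity, \<open>x\<close> itself need not be such a polynomial, but it
  acts on them from the left by \<open>x (\<Sum> b\<^sub>j x\<^sup>j) = \<Sum> (\<sigma> b\<^sub>j x\<^sup>j\<^sup>+\<^sup>1 + D b\<^sub>j x\<^sup>j)\<close>.
\<close>

definition ore_x :: "('a::ring \<Rightarrow> 'a) \<Rightarrow> ('a \<Rightarrow> 'a) \<Rightarrow> 'a poly \<Rightarrow> 'a poly" where
  "ore_x \<sigma> D q = pCons 0 (map_poly \<sigma> q) + map_poly D q"

definition ore_mult :: "('a::ring \<Rightarrow> 'a) \<Rightarrow> ('a \<Rightarrow> 'a) \<Rightarrow> 'a poly \<Rightarrow> 'a poly \<Rightarrow> 'a poly" where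
  "ore_mult \<sigma> D p q = (\<Sum>i\<le>degree p. map_poly ((*) (coeff p i)) ((ore_x \<sigma> D ^^ i) q))"

locale ore_data =
  fixes \<sigma> D :: "'a::ring \<Rightarrow> 'a"
  assumes automorphism: "ring_automorphism \<sigma>" and derivation: "skew_derivation \<sigma> D"
begin

lemma sigma_simps [simp]: "\<sigma> 0 = 0" "\<sigma> (a + b) = \<sigma> a + \<sigma> b" "\<sigma> (a * b) = \<sigma> a * \<sigma> b"
  using automorphism by (auto simp: ring_automorphism_def additive.add additive.zero)

lemma D_simps [simp]: "D 0 = 0" "D (a + b) = D a + D b" "D (a * b) = \<sigma> a * D b + D a * b"
  using derivation by (auto simp: skew_derivation_def additive.add additive.zero)

lemma map_poly_additive:
  fixes f :: "'a \<Rightarrow> 'a"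
  assumes "f 0 = 0" "\<And>a b. f (a + b) = f a + f b"
  shows "map_poly f (p + q) = map_poly f p + map_poly f q"
  by (rule poly_eqI) (simp add: coeff_map_poly assms)

lemma ore_x_add [simp]: "ore_x \<sigma> D (p + q) = ore_x \<sigma> D p + ore_x \<sigma> D q"
  by (rule poly_eqI)
     (simp add: ore_x_def coeff_map_poly coeff_pCons add_ac split: nat.splits)

lemma ore_x_0 [simp]: "ore_x \<sigma> D 0 = 0"
  by (simp add: ore_x_def)

lemma ore_x_pow_0 [simp]: "(ore_x \<sigma> D ^^ i) 0 = 0"
  by (induction i) auto

lemma ore_x_pow_add: "(ore_x \<sigma> D ^^ i) (p + q) = (ore_x \<sigma> D ^^ i) p + (ore_x \<sigma> D ^^ i) q"
  by (induction i) auto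

lemma ore_mult_upto:
  assumes "degree p \<le> n"
  shows "ore_mult \<sigma> D p q = (\<Sum>i\<le>n. map_poly ((*) (coeff p i)) ((ore_x \<sigma> D ^^ i) q))"
  unfolding ore_mult_def
proof (rule sum.mono_neutral_left)
  have "map_poly ((*) 0) r = 0" for r :: "'a poly"
    by (rule poly_eqI) (simp add: coeff_map_poly)
  then show "\<forall>i\<in>{..n} - {..degree p}. map_poly ((*) (coeff p i)) ((ore_x \<sigma> D ^^ i) q) = 0"
    by (auto simp: coeff_eq_0)
qed (use assms in auto)

lemma ore_mult_pCons:
  "ore_mult \<sigma> D (pCons a p) q = map_poly ((*) a) q + ore_mult \<sigma> D p (ore_x \<sigma> D q)"
proof -
  have "ore_mult \<sigma> D (pCons a p) q =
      (\<Sum>i\<le>Suc (degree p). map_poly ((*) (coeff (pCons a p) i)) ((ore_x \<sigma> D ^^ i) q))"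
    by (rule ore_mult_upto) (rule degree_pCons_le)
  then show ?thesis
    by (simp add: sum.atMost_Suc_shift ore_mult_def funpow_swap1 del: sum.atMost_Suc)
qed

lemma ore_mult_0_left [simp]: "ore_mult \<sigma> D 0 q = 0"
  by (rule poly_eqI) (simp add: ore_mult_def coeff_map_poly)

lemma ore_mult_add_left:
  "ore_mult \<sigma> D (p + p') q = ore_mult \<sigma> D p q + ore_mult \<sigma> D p' q"
proof -
  define n where "n = max (degree p) (degree p')"
  have "map_poly ((*) (a + b)) r = map_poly ((*) a) r + map_poly ((*) b) r"
    for a b and r :: "'a poly"
    by (rule poly_eqI) (simp add: coeff_map_poly distrib_right)
  then show ?thesis
    by (simp add: ore_mult_upto[of _ n] n_def degree_add_le_max sum.distrib)
qed

lemma ore_mult_add_right: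
  "ore_mult \<sigma> D p (q + q') = ore_mult \<sigma> D p q + ore_mult \<sigma> D p q'"
  by (simp add: ore_mult_def ore_x_pow_add map_poly_additive distrib_left sum.distrib)

text \<open>The rule \<open>x a = \<sigma>(a) x + D(a)\<close>, with a coefficient \<open>b\<close> in front of \<open>x\<close>.\<close>

lemma ore_mult_x: "ore_mult \<sigma> D [:0, b:] [:a:] = [:b * D a, b * \<sigma> a:]"
  by (simp add: ore_mult_pCons ore_x_def map_poly_pCons map_poly_additive)

lemma ore_mult_const: "ore_mult \<sigma> D [:a:] [:b:] = [:a * b:]"
  by (simp add: ore_mult_pCons map_poly_pCons)

lemma ore_x_scale:
  "ore_x \<sigma> D (map_poly ((*) a) q) = map_poly ((*) (\<sigma> a)) (ore_x \<sigma> D q) + map_poly ((*) (D a)) q"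
  by (rule poly_eqI)
     (simp add: ore_x_def coeff_map_poly coeff_pCons distrib_left algebra_simps split: nat.splits)

lemma ore_x_mult: "ore_x \<sigma> D (ore_mult \<sigma> D p q) = ore_mult \<sigma> D (ore_x \<sigma> D p) q"
proof (induction p arbitrary: q)
  case (pCons a p)
  have "ore_x \<sigma> D (pCons a p) = [:D a:] + pCons 0 ([:\<sigma> a:] + ore_x \<sigma> D p)"
    by (rule poly_eqI)
       (simp add: ore_x_def coeff_map_poly coeff_pCons algebra_simps split: nat.splits)
  moreover have "map_poly ((*) 0) r = 0" for r :: "'a poly"
    by (rule poly_eqI) (simp add: coeff_map_poly)
  ultimately show ?case
    by (simp add: ore_mult_pCons ore_mult_add_left ore_x_scale pCons.IH add_ac)
qed simp

lemma ore_mult_scale: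
  "ore_mult \<sigma> D (map_poly ((*) a) p) q = map_poly ((*) a) (ore_mult \<sigma> D p q)"
proof (induction p arbitrary: q)
  case (pCons b p)
  have "map_poly ((*) (a * b)) q = map_poly ((*) a) (map_poly ((*) b) q)"
    by (rule poly_eqI) (simp add: coeff_map_poly mult.assoc)
  then show ?case
    by (simp add: map_poly_pCons ore_mult_pCons pCons.IH map_poly_additive distrib_left)
qed simp

lemma ore_mult_assoc:
  "ore_mult \<sigma> D (ore_mult \<sigma> D p q) r = ore_mult \<sigma> D p (ore_mult \<sigma> D q r)"
  by (induction p arbitrary: q)
     (simp_all add: ore_mult_pCons ore_mult_add_left ore_mult_scale ore_x_mult)

sublocale ore: nonunital_ring "ore_mult \<sigma> D"
  by unfold_locales (simp_all add: ore_mult_assoc ore_mult_add_left ore_mult_add_right)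

end


section \<open>Algebras over a field\<close>

locale nonunital_algebra = vector_space scale
  for scale :: "'k::field \<Rightarrow> 'a::ring \<Rightarrow> 'a" +
  assumes scale_mult_left: "scale c (a * b) = scale c a * b"
    and scale_mult_right: "scale c (a * b) = a * scale c b"

end

theory Submission
  imports Defs
begin

text \<open>
  Left multiplication by \<open>x\<close> is the sum of the commuting additive maps \<open>b x\<^sup>j \<mapsto> \<sigma>(b) x\<^sup>j\<^sup>+\<^sup>1\<close> and
  \<open>b x\<^sup>j \<mapsto> D(b) x\<^sup>j\<close>, so in characteristic \<open>p\<close> its \<open>p\<^sup>k\<close>-th iterate is the sum of their \<open>p\<^sup>k\<close>-th
  iterates, and the second one vanishes on a given polynomial for large \<open>k\<close>.  Hence, for
  \<open>a\<close> in the radical and \<open>c = a\<^sup>2\<close>, there is \<open>N > 0\<close> such that \<open>x\<^sup>N\<close> commutes with \<open>c\<close>.  As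
  \<open>c x\<^sup>N = a (a x\<^sup>N)\<close> lies in the radical, it has a quasi-inverse \<open>b\<close>, and iterating
  \<open>b = c x\<^sup>N b - c x\<^sup>N\<close> gives \<open>b = c\<^sup>m x\<^sup>m\<^sup>N b - (c x\<^sup>N + \<dots> + c\<^sup>m x\<^sup>m\<^sup>N)\<close>.  If \<open>m\<close> is a large
  power of \<open>p\<close>, then \<open>x\<^sup>m\<^sup>N b\<close> has no terms of degree below \<open>m N\<close>; comparing the coefficients
  just above the degree of \<open>b\<close> shows that a power of \<open>c\<close> is zero.
\<close>

section \<open>Powers of sums of commuting additive maps\<close>

text \<open>The multiple \<open>m x\<close> in an additive group is written as the constant sum \<open>\<Sum>i<m. x\<close>.\<close>

lemma sum_const_add:
  fixes x :: "'b::comm_monoid_add" and m n :: nat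
  shows "(\<Sum>i<m + n. x) = (\<Sum>i<m. x) + (\<Sum>i<n. x)"
  by (induction n) (simp_all add: add_ac)

lemma sum_const_dvd_eq_0:
  fixes x :: "'b::comm_monoid_add" and m p :: nat
  assumes "(\<Sum>i<p. x) = 0" "p dvd m"
  shows "(\<Sum>i<m. x) = 0"
proof -
  have "(\<Sum>i<p * r. x) = 0" for r
    by (induction r) (simp_all add: sum_const_add assms(1))
  then show ?thesis using assms(2) by (auto elim: dvdE)
qed

lemma funpow_additive:
  fixes f :: "'b::ab_group_add \<Rightarrow> 'b"
  assumes "additive f"
  shows "additive (f ^^ n)"
  using assms by (induction n) (simp_all add: additive_def)

lemma funpow_commute:
  assumes "\<And>x. f (g x) = g (f x)"
  shows "(f ^^ m) ((g ^^ n) x) = (g ^^ n) ((f ^^ m) x)"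
proof -
  have "f ((g ^^ n) x) = (g ^^ n) (f x)" for x
    by (induction n) (simp_all add: assms)
  then show ?thesis by (induction m) simp_all
qed

lemma funpow_add_binomial:
  fixes f g :: "'b::ab_group_add \<Rightarrow> 'b"
  assumes f: "additive f" and g: "additive g" and comm: "\<And>x. f (g x) = g (f x)"
  shows "((\<lambda>x. f x + g x) ^^ n) x =
    (\<Sum>k\<le>n. \<Sum>i<n choose k. (f ^^ k) ((g ^^ (n - k)) x))"
proof (induction n)
  case (Suc n)
  let ?t = "\<lambda>k l. (f ^^ k) ((g ^^ l) x)"
  have "((\<lambda>x. f x + g x) ^^ Suc n) x =
      (\<Sum>k\<le>n. \<Sum>i<n choose k. f (?t k (n - k))) + (\<Sum>k\<le>n. \<Sum>i<n choose k. g (?t k (n - k)))"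
    by (simp add: Suc.IH additive.sum[OF f] additive.sum[OF g])
  also have "(\<Sum>k\<le>n. \<Sum>i<n choose k. g (?t k (n - k))) =
      (\<Sum>k\<le>n. \<Sum>i<n choose k. ?t k (Suc n - k))"
  proof (intro sum.cong refl)
    fix k assume "k \<in> {..n}"
    moreover have "g (?t k (n - k)) = (f ^^ k) (g ((g ^^ (n - k)) x))"
      using funpow_commute[where f = f and g = g and m = k and n = 1, OF comm] by simp
    ultimately show "g (?t k (n - k)) = ?t k (Suc n - k)"
      by (simp add: Suc_diff_le)
  qed
  \<comment> \<open>The added summand at \<open>k = Suc n\<close> is empty since
    \<open>n choose Suc n\<close> is 0; it makes the index shift line up for Pascal's rule.\<close>
  also have "\<dots> = (\<Sum>k\<le>Suc n. \<Sum>i<n choose k. ?t k (Suc n - k))"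
    by (simp add: binomial_eq_0)
  also have "\<dots> = ?t 0 (Suc n) + (\<Sum>k\<le>n. \<Sum>i<n choose Suc k. ?t (Suc k) (n - k))"
    by (simp add: sum.atMost_Suc_shift del: sum.atMost_Suc)
  finally have "((\<lambda>x. f x + g x) ^^ Suc n) x = ?t 0 (Suc n) +
      (\<Sum>k\<le>n. \<Sum>i<(n choose k) + (n choose Suc k). ?t (Suc k) (n - k))"
    by (simp add: sum_const_add sum.distrib add_ac)
  then show ?case
    by (simp add: sum.atMost_Suc_shift del: sum.atMost_Suc)
qed simp

text \<open>The prime \<open>p\<close> divides every inner binomial coefficient, so only the two end
  terms survive.\<close>

lemma funpow_add_prime:
  fixes f g :: "'b::ab_group_add \<Rightarrow> 'b" and p :: nat
  assumes f: "additive f" and g: "additive g" and comm: "\<And>x. f (g x) = g (f x)"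
    and p: "prime p" "\<And>x::'b. (\<Sum>i<p. x) = 0"
  shows "((\<lambda>x. f x + g x) ^^ p) x = (f ^^ p) x + (g ^^ p) x"
proof -
  let ?t = "\<lambda>k. \<Sum>i<p choose k. (f ^^ k) ((g ^^ (p - k)) x)"
  have "p > 0" using p(1) by (rule prime_gt_0_nat)
  have "((\<lambda>x. f x + g x) ^^ p) x = (\<Sum>k\<le>p. ?t k)"
    by (rule funpow_add_binomial[OF f g comm])
  also have "\<dots> = (\<Sum>k\<in>{0, p}. ?t k)"
  proof (rule sum.mono_neutral_right)
    have "?t k = 0" if "k \<in> {..p} - {0, p}" for k
    proof (rule sum_const_dvd_eq_0[OF p(2)])
      show "p dvd (p choose k)" using that p(1) by (intro dvd_choose_prime) auto
    qed
    then show "\<forall>k\<in>{..p} - {0, p}. ?t k = 0" by blast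
  qed auto
  finally show ?thesis using \<open>p > 0\<close> by (simp add: add_ac)
qed

lemma funpow_add_prime_power:
  fixes f g :: "'b::ab_group_add \<Rightarrow> 'b" and p :: nat
  assumes f: "additive f" and g: "additive g" and comm: "\<And>x. f (g x) = g (f x)"
    and p: "prime p" "\<And>x::'b. (\<Sum>i<p. x) = 0"
  shows "((\<lambda>x. f x + g x) ^^ (p ^ k)) x = (f ^^ (p ^ k)) x + (g ^^ (p ^ k)) x"
proof (induction k arbitrary: x)
  case (Suc k)
  let ?q = "p ^ k"
  have "((\<lambda>x. f x + g x) ^^ (p ^ Suc k)) x = (((\<lambda>x. f x + g x) ^^ ?q) ^^ p) x"
    by (simp only: funpow_mult power_Suc2)
  also have "(\<lambda>x. f x + g x) ^^ ?q = (\<lambda>x. (f ^^ ?q) x + (g ^^ ?q) x)"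
    by (rule ext) (rule Suc.IH)
  also have "((\<lambda>x. (f ^^ ?q) x + (g ^^ ?q) x) ^^ p) x = ((f ^^ ?q) ^^ p) x + ((g ^^ ?q) ^^ p) x"
  proof (rule funpow_add_prime)
    show "additive (f ^^ ?q)" "additive (g ^^ ?q)" by (intro funpow_additive f g)+
    show "(f ^^ ?q) ((g ^^ ?q) x) = (g ^^ ?q) ((f ^^ ?q) x)" for x
      by (rule funpow_commute) (rule comm)
  qed (rule p)+
  finally show ?case by (simp only: funpow_mult power_Suc2)
qed simp

text \<open>Turns the characteristic of the field into a scalar-free fact about the additive group
  of the algebra.\<close>

lemma (in nonunital_algebra) sum_const_CHAR: "(\<Sum>i<CHAR('k). x) = (0::'a)"
proof -
  have "(\<Sum>i<n. x) = scale (of_nat n) x" for n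
    by (induction n) (simp_all add: scale_left_distrib add.commute)
  then show ?thesis by simp
qed


section \<open>Iterated multiplication by the variable\<close>

locale commuting_ore_data = ore_data +
  assumes sigma_D: "\<sigma> (D a) = D (\<sigma> a)"
begin

text \<open>The \<sigma>-part of left multiplication by x: \<open>ore_x\<close> is the sum of
  \<open>shift\<close> and \<open>map_poly D\<close>.\<close>

definition shift :: "'a poly \<Rightarrow> 'a poly" where
  "shift q = pCons 0 (map_poly \<sigma> q)"

lemma coeff_shift_funpow:
  "coeff ((shift ^^ n) q) j = (if j < n then 0 else (\<sigma> ^^ n) (coeff q (j - n)))"
  by (induction n arbitrary: j) (auto simp: shift_def coeff_pCons coeff_map_poly split: nat.splits)

lemma coeff_map_D_funpow: "coeff ((map_poly D ^^ n) q) j = (D ^^ n) (coeff q j)"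
  by (induction n) (simp_all add: coeff_map_poly)

lemma additive_shift: "additive shift"
  by (simp add: additive_def shift_def map_poly_additive)

lemma additive_map_D: "additive (map_poly D)"
  by (simp add: additive_def map_poly_additive)

lemma shift_map_D: "shift (map_poly D q) = map_poly D (shift q)"
  by (rule poly_eqI) (auto simp: shift_def coeff_pCons coeff_map_poly sigma_D split: nat.splits)

lemma map_D_nilpotent_eventually:
  assumes "locally_nilpotent D"
  shows "\<exists>n. \<forall>m\<ge>n. (map_poly D ^^ m) q = 0"
proof -
  have D0: "(D ^^ m) 0 = 0" for m by (induction m) simp_all
  have "\<exists>n. \<forall>m\<ge>n. (D ^^ m) a = 0" for a
  proof -
    obtain n where n: "(D ^^ n) a = 0" using assms by (auto simp: locally_nilpotent_def)
    have "(D ^^ m) a = 0" if "m \<ge> n" for m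
    proof -
      have "(D ^^ m) a = (D ^^ (m - n)) ((D ^^ n) a)"
        using that by (simp flip: funpow_add[THEN fun_cong, unfolded comp_def])
      then show ?thesis by (simp add: n D0)
    qed
    then show ?thesis by blast
  qed
  then obtain h where h: "\<And>a m. m \<ge> h a \<Longrightarrow> (D ^^ m) a = 0" by metis
  \<comment> \<open>Thresholds are natural numbers, so their sum bounds each of them.\<close>
  have "(map_poly D ^^ m) q = 0" if "m \<ge> (\<Sum>j\<le>degree q. h (coeff q j))" for m
  proof (rule poly_eqI)
    fix j
    show "coeff ((map_poly D ^^ m) q) j = coeff 0 j"
    proof (cases "j \<le> degree q")
      case True
      then have "h (coeff q j) \<le> (\<Sum>j\<le>degree q. h (coeff q j))"
        by (intro member_le_sum) auto
      then show ?thesis using that h by (simp add: coeff_map_D_funpow)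
    qed (simp add: coeff_map_D_funpow coeff_eq_0 D0)
  qed
  then show ?thesis by blast
qed

lemma ore_x_funpow_eq_shift:
  fixes p :: nat
  assumes p: "prime p" "\<And>x::'a. (\<Sum>i<p. x) = 0" and q: "(map_poly D ^^ (p ^ k)) q = 0"
  shows "(ore_x \<sigma> D ^^ (p ^ k * m)) q = (shift ^^ (p ^ k * m)) q"
proof -
  let ?P = "p ^ k"
  have "(\<Sum>i<p. r) = 0" for r :: "'a poly"
    by (rule poly_eqI) (simp add: coeff_sum p)
  then have X: "(ore_x \<sigma> D ^^ ?P) r = (shift ^^ ?P) r + (map_poly D ^^ ?P) r" for r
    using funpow_add_prime_power[OF additive_shift additive_map_D shift_map_D p(1), of k r]
    by (simp add: ore_x_def[abs_def] shift_def[abs_def])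
  \<comment> \<open>The induction on \<open>m\<close> needs the D-part to vanish along the whole
    shift orbit of \<open>q\<close>.\<close>
  have "(map_poly D ^^ ?P) ((shift ^^ n) q) = 0" for n
    using funpow_commute[of shift "map_poly D" n ?P q] shift_map_D q
      additive.zero[OF funpow_additive[OF additive_shift]] by simp
  then have "((ore_x \<sigma> D ^^ ?P) ^^ m) q = ((shift ^^ ?P) ^^ m) q"
    by (induction m) (simp_all add: X funpow_mult funpow_add)
  then show ?thesis by (simp add: funpow_mult)
qed

lemma ore_x_funpow_mult:
  "(ore_x \<sigma> D ^^ n) (ore_mult \<sigma> D p q) = ore_mult \<sigma> D ((ore_x \<sigma> D ^^ n) p) q"
  by (induction n) (simp_all add: ore_x_mult)

lemma ore_mult_const_left: "ore_mult \<sigma> D [:c:] q = map_poly ((*) c) q"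
  by (simp add: ore_mult_pCons)

text \<open>The second assumption on \<open>N\<close> says that x^(N m) commutes with
  \<open>c\<close>; it is phrased through \<open>ore_x\<close> because x need not lie in the
  ring.\<close>

lemma quasi_regular_monom_imp_nilpotent:
  fixes p :: nat
  assumes p: "prime p" "\<And>x::'a. (\<Sum>i<p. x) = 0" and D: "locally_nilpotent D"
    and N: "N > 0" "\<And>m. (ore_x \<sigma> D ^^ (N * m)) [:c:] = monom c (N * m)"
    and qr: "quasi_regular (ore_mult \<sigma> D) (monom c N)"
  shows "nilpotent_elem (*) c"
proof -
  let ?u = "monom c N"
  let ?U = "ore_mult \<sigma> D ?u" and ?X = "ore_x \<sigma> D"
  obtain b where "?u + b - ?U b = 0" using qr by (auto simp: quasi_regular_def)
  then have b: "b = ?U b - ?u" by (simp add: algebra_simps)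
  have u: "(?X ^^ N) [:c:] = ?u" using N(2)[of 1] by simp
  have U: "?U q = map_poly ((*) c) ((?X ^^ N) q)" for q
  proof -
    have "?U q = (\<Sum>i\<le>N. map_poly ((*) (coeff ?u i)) ((?X ^^ i) q))"
      by (rule ore_mult_upto) (rule degree_monom_le)
    moreover have "map_poly ((*) 0) r = 0" for r :: "'a poly"
      by (rule poly_eqI) (simp add: coeff_map_poly)
    then have "(\<Sum>i\<le>N. map_poly ((*) (coeff ?u i)) ((?X ^^ i) q)) =
        (\<Sum>i\<in>{N}. map_poly ((*) (coeff ?u i)) ((?X ^^ i) q))"
      by (intro sum.mono_neutral_right) auto
    ultimately show ?thesis by simp
  qed
  \<comment> \<open>Associativity: x^N (c q) = (x^N c) q, and x^N c is \<open>?u\<close>.\<close>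
  have comm: "map_poly ((*) c) ((?X ^^ N) q) = (?X ^^ N) (map_poly ((*) c) q)" for q
    using U[of q] by (simp add: ore_x_funpow_mult u flip: ore_mult_const_left)
  have Upow: "(?U ^^ m) q = (map_poly ((*) c) ^^ m) ((?X ^^ (N * m)) q)" for m q
  proof (induction m)
    case (Suc m)
    have "(?U ^^ Suc m) q = (map_poly ((*) c) ^^ Suc m) ((?X ^^ N) ((?X ^^ (N * m)) q))"
      using funpow_commute[of "map_poly ((*) c)" "?X ^^ N" m 1] comm by (simp add: Suc.IH U)
    then show ?case by (simp add: funpow_add)
  qed simp
  have coeff_cpow: "coeff ((map_poly ((*) c) ^^ m) q) j = ((*) c ^^ m) (coeff q j)" for m q j
    by (induction m) (simp_all add: coeff_map_poly)
  have c0: "((*) c ^^ m) 0 = 0" for m by (induction m) simp_all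
  have Xc: "(?X ^^ (N * m)) ?u = monom c (N * Suc m)" for m
  proof -
    have "(?X ^^ (N * m)) ?u = (?X ^^ (N * Suc m)) [:c:]"
      using funpow_add[of "N * m" N ?X] by (simp add: add.commute flip: u)
    then show ?thesis by (simp only: N(2))
  qed
  have addU: "additive ?U" by (simp add: additive_def ore_mult_add_right)
  have iter: "b = (?U ^^ m) b - (\<Sum>i<m. (?U ^^ i) ?u)" for m
  proof (induction m)
    case (Suc m)
    have "(?U ^^ m) b = (?U ^^ m) (?U b - ?u)" using b by simp
    also have "\<dots> = (?U ^^ Suc m) b - (?U ^^ m) ?u"
      using additive.diff[OF funpow_additive[OF addU]] by (simp add: funpow_swap1)
    finally show ?case
      using Suc.IH by (metis (no_types, lifting) sum.lessThan_Suc diff_diff_eq add.commute)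
  qed simp
  define d where "d = degree b"
  obtain n where n: "\<And>m. m \<ge> n \<Longrightarrow> (map_poly D ^^ m) b = 0"
    using map_D_nilpotent_eventually[OF D] by blast
  \<comment> \<open>A power of \<open>p\<close> larger than \<open>n\<close>, to kill the D-part on
    \<open>b\<close>, and larger than \<open>Suc d\<close>, to push x^(N m) b above degree
    \<open>N * Suc d\<close>.\<close>
  define m where "m = p ^ (n + d + 1)"
  have m: "m > n + d + 1" unfolding m_def using p(1) by (intro power_gt_expt prime_gt_Suc_0_nat)
  have "(?X ^^ (N * m)) b = (shift ^^ (N * m)) b"
    using ore_x_funpow_eq_shift[OF p, of "n + d + 1" b N] n[of m] m
    by (simp add: m_def mult.commute)
  then have "coeff ((?U ^^ m) b) (N * Suc d) = 0"
    using m N(1) by (simp add: Upow coeff_cpow coeff_shift_funpow c0 del: mult_Suc_right)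
  moreover have "coeff b (N * Suc d) = 0"
    using N(1) by (intro coeff_eq_0) (cases N, simp_all add: d_def)
  \<comment> \<open>The \<open>i\<close>-th term is c^(i+1) x^(N(i+1)), so only \<open>i = d\<close>
    reaches this degree.\<close>
  moreover have "(\<Sum>i<m. coeff ((?U ^^ i) ?u) (N * Suc d)) =
      (\<Sum>i\<in>{d}. coeff ((?U ^^ i) ?u) (N * Suc d))"
    using m N(1) by (intro sum.mono_neutral_right) (auto simp: Upow Xc coeff_cpow c0)
  ultimately have "((*) c ^^ d) c = 0"
    using arg_cong[OF iter[of m], of "\<lambda>q. coeff q (N * Suc d)"]
    by (simp add: coeff_sum Upow Xc coeff_cpow del: mult_Suc_right)
  then show ?thesis by (auto simp: nilpotent_elem_def)
qed

end

section \<open>Intersecting the radical with the coefficient ring\<close>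

theorem theorem3:
  fixes scale :: "'k::field \<Rightarrow> 'a::ring \<Rightarrow> 'a"
    and \<sigma> D :: "'a \<Rightarrow> 'a"
  assumes "nonunital_algebra scale" and "CHAR('k) > 0"
    and "ring_automorphism \<sigma>" and "locally_torsion \<sigma>"
    and "skew_derivation \<sigma> D" and "locally_nilpotent D"
    and "\<sigma> \<circ> D = D \<circ> \<sigma>"
  shows "nil_ideal (*) {a. [:a:] \<in> jacobson_radical (ore_mult \<sigma> D)}"
proof -
  interpret nonunital_algebra scale by fact
  interpret commuting_ore_data \<sigma> D
    using assms(3,5,7) by unfold_locales (auto simp: fun_eq_iff)
  let ?J = "jacobson_radical (ore_mult \<sigma> D)" and ?p = "CHAR('k)"
  have p: "prime ?p" using assms(2) by (rule prime_CHAR_semidom)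
  have J: "left_ideal (ore_mult \<sigma> D) ?J" "\<And>a s. a \<in> ?J \<Longrightarrow> ore_mult \<sigma> D a s \<in> ?J"
    using ore.jacobson_radical_two_sided_ideal by (auto simp: two_sided_ideal_def)
  have "two_sided_ideal (*) {a. [:a:] \<in> ?J}"
    unfolding two_sided_ideal_def left_ideal_def
  proof (intro conjI ballI allI)
    show "0 \<in> {a. [:a:] \<in> ?J}" using ore.left_idealD(1)[OF J(1)] by simp
  next
    fix a b assume "a \<in> {a. [:a:] \<in> ?J}" "b \<in> {a. [:a:] \<in> ?J}"
    then show "a + b \<in> {a. [:a:] \<in> ?J}" using ore.left_idealD(2)[OF J(1), of "[:a:]" "[:b:]"] by simp
  next
    fix a assume "a \<in> {a. [:a:] \<in> ?J}"
    then show "- a \<in> {a. [:a:] \<in> ?J}" using ore.left_idealD(3)[OF J(1), of "[:a:]"] by simp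
  next
    fix s a assume "a \<in> {a. [:a:] \<in> ?J}"
    then show "s * a \<in> {a. [:a:] \<in> ?J}" "a * s \<in> {a. [:a:] \<in> ?J}"
      using ore.left_idealD(4)[OF J(1), of "[:a:]" "[:s:]"] J(2)[of "[:a:]" "[:s:]"]
      by (simp_all add: ore_mult_const)
  qed
  moreover have "nilpotent_elem (*) a" if a: "[:a:] \<in> ?J" for a
  proof -
    \<comment> \<open>The square leaves one factor \<open>a\<close> to form the ring element a x^N,
      as x^N alone may be missing.\<close>
    let ?c = "a * a"
    obtain n where n: "n > 0" "(\<sigma> ^^ n) ?c = ?c"
      using assms(4) unfolding locally_torsion_def by blast
    obtain k where k: "\<And>m. m \<ge> k \<Longrightarrow> (map_poly D ^^ m) [:?c:] = 0"
      using map_D_nilpotent_eventually[OF assms(6)] by blast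
    \<comment> \<open>The factor \<open>n\<close> makes \<sigma>^N fix \<open>?c\<close>; the factor
      \<open>?p ^ k\<close> exceeds \<open>k\<close> and removes the D-part.\<close>
    define N where "N = ?p ^ k * n"
    have "k < ?p ^ k" using p by (intro power_gt_expt prime_gt_Suc_0_nat)
    have "(ore_x \<sigma> D ^^ (N * m)) [:?c:] = monom ?c (N * m)" for m
    proof -
      have "(\<sigma> ^^ (n * l)) ?c = ?c" for l
        by (induction l) (simp_all add: funpow_add n(2) del: sigma_simps)
      from this[of "?p ^ k * m"] have "(\<sigma> ^^ (N * m)) ?c = ?c"
        by (simp add: N_def mult_ac del: sigma_simps)
      moreover have "(\<sigma> ^^ i) 0 = 0" for i by (induction i) simp_all
      moreover have "(ore_x \<sigma> D ^^ (N * m)) [:?c:] = (shift ^^ (N * m)) [:?c:]"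
        using ore_x_funpow_eq_shift[OF p sum_const_CHAR k, of k "n * m"] \<open>k < ?p ^ k\<close>
        by (simp add: N_def mult.assoc)
      ultimately show ?thesis
        by (intro poly_eqI) (auto simp: coeff_shift_funpow coeff_pCons split: nat.splits)
    qed
    moreover have "N > 0" using n(1) p by (simp add: N_def prime_gt_0_nat)
    moreover have "monom ?c N \<in> ?J"
      using J(2)[OF a, of "monom a N"] by (simp add: ore_mult_const_left map_poly_monom)
    then have "quasi_regular (ore_mult \<sigma> D) (monom ?c N)"
      by (rule ore.jacobson_radical_quasi_regular)
    ultimately have "nilpotent_elem (*) ?c"
      by (intro quasi_regular_monom_imp_nilpotent[OF p sum_const_CHAR assms(6)])
    then obtain d where "((*) ?c ^^ d) ?c = 0" by (auto simp: nilpotent_elem_def)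
    \<comment> \<open>With the iterate convention, the vanishing power c^(d+1) is a^(2d+2), hence
      the exponent \<open>d + d + 1\<close> below.\<close>
    moreover have "((*) ?c ^^ d) b = ((*) a ^^ (d + d)) b" for b
      by (induction d) (simp_all add: mult.assoc)
    ultimately have "((*) a ^^ (d + d + 1)) a = 0" by (simp add: funpow_swap1)
    then show ?thesis unfolding nilpotent_elem_def by blast
  qed
  ultimately show ?thesis by (simp add: nil_ideal_def)
qed

end
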